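(* Let $t$ be a positive integer, let $\lambda$ be a self-conjugate partition, and let $\Omega(\lambda)=(\tilde{\lambda},\lambda^0,\lambda^1,\ldots,\lambda^{t-1})$ be its image under the Littlewood decomposition. The following properties hold. (i) If $t=2t'+1$ is odd, then $\delta_\lambda = \delta_{\tilde{\lambda}}\,\delta_{\lambda^{t'}}$. If $t$ is even, then $\delta_\lambda = \delta_{\tilde{\lambda}}$. (ii) If $t=2t'+1$ is odd, let $v$ be a box of $\lambda^{t'}$ and let $V$ be the box of $\lambda$ canonically associated with $v$. The box $v$ is strictly above the principal diagonal of $\lambda^{t'}$ if and only if $V$ is strictly above the principal diagonal of $\lambda$. (iii) Write $t=2t'$ or $t=2t'+1$ according to the parity of $t$, and let $i\in\{0,\ldots,t'-1\}$. Let $v=(j,k)$ be a box of $\lambda^{i}$, denote by $v^*$ the box $(k,j)$ of $\lambda^{i*}=\lambda^{t-1-i}$, and by $V$ and $V^*$ the boxes of $\lambda$ canonically associated with $v$ and $v^*$ respectively. If $V$ is strictly above (respectively strictly below) the principal diagonal of $\lambda$, then $V^*$ is strictly below (respectively strictly above) the principal diagonal of $\lambda$. In particular, we have $\varepsilon_V\,\varepsilon_{V^*}=\varepsilon_v\,\varepsilon_{v^*}=-1$.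
   Context: A partition $\lambda=(\lambda_1,\ldots,\lambda_\ell)$ is a finite non-increasing sequence of positive integers (possibly empty). Its Ferrers diagram (French convention: row $1$ at the bottom) is the set of boxes $(j,k)$ with $1\le j\le\ell$ (row) and $1\le k\le\lambda_j$ (column). The principal diagonal consists of the boxes $(i,i)$; a box $(j,k)$ is strictly above it if $j>k$ and strictly below it if $j<k$. For a box $v$, $\varepsilon_v=-1$ if $v$ is strictly above the principal diagonal of the partition containing it, and $\varepsilon_v=1$ otherwise. $\lambda^*$ is the conjugate of $\lambda$ (reflection in the principal diagonal), $\lambda^{i*}$ denotes $(\lambda^i)^*$, and $\lambda$ is self-conjugate if $\lambda=\lambda^*$. $D(\lambda)$ is the side length of the largest square contained in the diagram, and $\delta_\lambda=(-1)^{D(\lambda)}$. Encoding. Read the upper-right border of the Ferrers diagram from top left to bottom right, writing $1$ for each horizontal edge and $0$ for each vertical edge, then add infinitely many $0$'s on the left and infinitely many $1$'s on the right. This gives a bi-infinite word $\psi(\lambda)$ (defined up to shift of indices), and $\psi$ is a bijection between partitions and bi-infinite $0/1$ words (up to shift) beginning with infinitely many $0$'s and ending with infinitely many $1$'s. The canonical representation $C_\lambda=(c_i)_{i\in\mathbb{Z}}$ is the unique indexing of $\psi(\lambda)$ with $\#\{i\le -1: c_i=1\}=\#\{i\ge 0: c_i=0\}$. Boxes of $\lambda$ are in one-to-one correspondence with pairs $(i,j)$, $i<j$, $c_i=1$, $c_j=0$: the box in row $r$ and column $s$ corresponds to the pair where $c_i$ is the $s$-th $1$ from the left and $c_j$ is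 the $r$-th $0$ from the right; its hook length is $j-i$. The same correspondence holds for any other indexing of $\psi(\lambda)$. Littlewood decomposition $\Omega$. For $0\le k\le t-1$ let $v^k=(c_{it+k})_{i\in\mathbb{Z}}$ and $\lambda^k=\psi^{-1}(v^k)$. Let $w^k$ be obtained from $v^k$ by repeatedly replacing subwords $10$ by $01$ until the form $\cdots000111\cdots$ is reached. The $t$-core $\tilde\lambda$ of $\lambda$ is the partition whose canonical representation has $w^0,\ldots,w^{t-1}$ as its $t$ sections. Then $\Omega(\lambda)=(\tilde\lambda,\lambda^0,\ldots,\lambda^{t-1})$. A box $v$ of $\lambda^k$, given by a pair of positions $(i,j)$ in $v^k$, is canonically associated with the box $V$ of $\lambda$ given by the pair $(it+k,jt+k)$ in $C_\lambda$. It is known that if $\lambda$ is self-conjugate then $\tilde\lambda$ is self-conjugate and $\lambda^{t-1-i}=\lambda^{i*}$ for $0\le i\le t-1$; in particular $\lambda^{t'}$ is self-conjugate if $t=2t'+1$.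
   Formalization: In (iii), the equation ε_v ε_{v*} = −1 is stated only for boxes v=(j,k) with j≠k, since for j=k one has v=v* and the product is 1 (e.g. t=2, λ=(2,2), v=(1,1)); ε_V ε_{V*} = −1 is stated for all boxes v. *)

theory Defs
  imports Main
begin

section \<open>Partitions and Ferrers diagrams\<close>

definition is_partition :: "nat list \<Rightarrow> bool" where
  "is_partition l \<longleftrightarrow> sorted_wrt (\<ge>) l \<and> (\<forall>x\<in>set l. 0 < x)"

text \<open>A box is a pair (row, column), both counted from 1. Rows are stacked upwards
  (French convention), so a box lies above the principal diagonal when its row index
  exceeds its column index.\<close>

definition boxes :: "nat list \<Rightarrow> (nat \<times> nat) set" where
  "boxes l = {(j, k). 1 \<le> j \<and> j \<le> length l \<and> 1 \<le> k \<and> k \<le> l ! (j - 1)}"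

definition strictly_above :: "nat \<times> nat \<Rightarrow> bool" where
  "strictly_above v \<longleftrightarrow> fst v > snd v"

definition strictly_below :: "nat \<times> nat \<Rightarrow> bool" where
  "strictly_below v \<longleftrightarrow> fst v < snd v"

definition eps :: "nat \<times> nat \<Rightarrow> int" where
  "eps v = (if strictly_above v then - 1 else 1)"

definition conjugate :: "nat list \<Rightarrow> nat list" where
  "conjugate l = (case l of [] \<Rightarrow> []
     | x # _ \<Rightarrow> map (\<lambda>k. length (filter (\<lambda>y. k \<le> y) l)) [1..<Suc x])"

definition self_conjugate :: "nat list \<Rightarrow> bool" where
  "self_conjugate l \<longleftrightarrow> conjugate l = l"

lemma boxes_conjugate:
  assumes "is_partition l"
  shows "boxes (conjugate l) = prod.swap ` boxes l"
proof -
  have cnt: "k \<le> length (filter (\<lambda>y. j \<le> y) l) \<longleftrightarrow> k \<le> length l \<and> j \<le> l ! (k - 1)"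
    if "1 \<le> k" and "sorted_wrt (\<ge>) l" for j k and l :: "nat list"
    using that
  proof (induction l arbitrary: k)
    case Nil
    then show ?case by simp
  next
    case (Cons x xs)
    show ?case
    proof (cases "j \<le> x")
      case True
      from Cons.prems(1) obtain m where k: "k = Suc m" by (cases k) auto
      show ?thesis
      proof (cases m)
        case 0
        then show ?thesis using True k by simp
      next
        case (Suc m')
        have "Suc m' \<le> length (filter (\<lambda>y. j \<le> y) xs) \<longleftrightarrow> Suc m' \<le> length xs \<and> j \<le> xs ! m'"
          using Cons.IH[of "Suc m'"] Cons.prems(2) by simp
        then show ?thesis using True k Suc by simp
      qed
    next
      case False
      then have none: "filter (\<lambda>y. j \<le> y) (x # xs) = []"
        using Cons.prems by (auto simp: filter_empty_conv)
      have "\<not> j \<le> (x # xs) ! (k - 1)" if "k \<le> length (x # xs)"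
      proof -
        have "(x # xs) ! (k - 1) \<in> set (x # xs)"
          using that Cons.prems by (intro nth_mem) auto
        then show ?thesis using none unfolding filter_empty_conv by blast
      qed
      then show ?thesis using none Cons.prems by auto
    qed
  qed
  have "(j, k) \<in> boxes (conjugate l) \<longleftrightarrow> (k, j) \<in> boxes l" for j k
  proof (cases l)
    case Nil
    then show ?thesis by (auto simp: boxes_def conjugate_def)
  next
    case (Cons x xs)
    have s: "sorted_wrt (\<ge>) l" using assms by (simp add: is_partition_def)
    have le: "l ! i \<le> x" if "i < length l" for i
      using that s Cons by (cases i) auto
    have nt: "conjugate l ! (j - 1) = length (filter (\<lambda>y. j \<le> y) l)" if "1 \<le> j" "j \<le> x"
      using that by (simp add: conjugate_def Cons nth_append del: upt_Suc)
    have len: "length (conjugate l) = x" by (simp add: conjugate_def Cons)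
    show ?thesis
    proof
      assume "(j, k) \<in> boxes (conjugate l)"
      then show "(k, j) \<in> boxes l"
        using nt len cnt[OF _ s, of k j] by (auto simp: boxes_def)
    next
      assume a: "(k, j) \<in> boxes l"
      then have "k - 1 < length l" "j \<le> l ! (k - 1)" by (auto simp: boxes_def)
      then have "j \<le> x" using le[of "k - 1"] by linarith
      then show "(j, k) \<in> boxes (conjugate l)"
        using a nt len cnt[OF _ s, of k j] by (auto simp: boxes_def)
    qed
  qed
  then show ?thesis by (force simp: image_iff)
qed

definition durfee :: "nat list \<Rightarrow> nat" where
  "durfee l = Max {d. \<exists>a b. {a<..a + d} \<times> {b<..b + d} \<subseteq> boxes l}"

definition delta :: "nat list \<Rightarrow> int" where
  "delta l = (- 1) ^ durfee l"


section \<open>Encoding by bi-infinite words\<close>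

text \<open>A bi-infinite 0/1 word is a function on the integers, with \<^term>\<open>True\<close> standing for
  the letter 1 (horizontal edge) and \<^term>\<open>False\<close> for the letter 0 (vertical edge).\<close>

type_synonym word = "int \<Rightarrow> bool"

text \<open>The border of the diagram from top left to bottom right. The list starts with the
  bottom row, so its head is read last: it contributes the horizontal edges by which it
  exceeds the row above it, followed by its vertical edge.\<close>

fun border :: "nat list \<Rightarrow> bool list" where
  "border [] = []"
| "border (x # xs) =
     border xs @ replicate (x - (case xs of [] \<Rightarrow> 0 | y # _ \<Rightarrow> y)) True @ [False]"

definition border_word :: "nat list \<Rightarrow> word" where
  "border_word l i =
     (if i < 0 then False
      else if i < int (length (border l)) then border l ! nat i
      else True)"

text \<open>As the word of a partition is only defined up to a shift of the indices,
  \<open>psi l\<close> is the set of all its indexings.\<close>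

definition psi :: "nat list \<Rightarrow> word set" where
  "psi l = {c. \<exists>n. \<forall>i. c i = border_word l (i + n)}"

definition psi_inv :: "word \<Rightarrow> nat list" where
  "psi_inv c = (THE l. is_partition l \<and> c \<in> psi l)"

definition canonical :: "nat list \<Rightarrow> word" where
  "canonical l = (THE c. c \<in> psi l \<and> card {i. i \<le> - 1 \<and> c i} = card {i. 0 \<le> i \<and> \<not> c i})"

text \<open>The pair of positions \<open>(i, j)\<close> in \<open>c\<close> corresponds to the box in row \<open>r\<close> and column
  \<open>s\<close>: the letter at \<open>i\<close> is the \<open>s\<close>-th 1 from the left, the letter at \<open>j\<close> the \<open>r\<close>-th 0
  from the right.\<close>

definition box_corresp :: "word \<Rightarrow> int \<times> int \<Rightarrow> nat \<times> nat \<Rightarrow> bool" where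
  "box_corresp c p v \<longleftrightarrow> (case (p, v) of ((i, j), (r, s)) \<Rightarrow>
     i < j \<and> c i \<and> \<not> c j \<and> card {x. x \<le> i \<and> c x} = s \<and> card {x. j \<le> x \<and> \<not> c x} = r)"

definition positions_of_box :: "word \<Rightarrow> nat \<times> nat \<Rightarrow> int \<times> int" where
  "positions_of_box c v = (THE p. box_corresp c p v)"

definition box_of_positions :: "word \<Rightarrow> int \<times> int \<Rightarrow> nat \<times> nat" where
  "box_of_positions c p = (THE v. box_corresp c p v)"


section \<open>Littlewood decomposition\<close>

definition word_section :: "nat \<Rightarrow> word \<Rightarrow> nat \<Rightarrow> word" where
  "word_section t c k = (\<lambda>i. c (i * int t + int k))"

definition swap_step :: "word \<Rightarrow> word \<Rightarrow> bool" where
  "swap_step c d \<longleftrightarrow> (\<exists>i. c i \<and> \<not> c (i + 1) \<and> d = c(i := False, i + 1 := True))"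

definition sorted_word :: "word \<Rightarrow> bool" where
  "sorted_word c \<longleftrightarrow> (\<exists>m. \<forall>i. c i \<longleftrightarrow> m \<le> i)"

definition sort_word :: "word \<Rightarrow> word" where
  "sort_word c = (THE w. swap_step\<^sup>*\<^sup>* c w \<and> sorted_word w)"

definition t_core :: "nat \<Rightarrow> nat list \<Rightarrow> nat list" where
  "t_core t l = (THE m. is_partition m \<and>
     (\<forall>k<t. word_section t (canonical m) k = sort_word (word_section t (canonical l) k)))"

definition littlewood :: "nat \<Rightarrow> nat list \<Rightarrow> nat list \<times> nat list list" where
  "littlewood t l =
     (t_core t l, map (\<lambda>k. psi_inv (word_section t (canonical l) k)) [0..<t])"

text \<open>The box of \<open>l\<close> canonically associated with the box \<open>v\<close> of the \<open>k\<close>-th component of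
  its quotient.\<close>

definition assoc_box :: "nat \<Rightarrow> nat list \<Rightarrow> nat \<Rightarrow> nat \<times> nat \<Rightarrow> nat \<times> nat" where
  "assoc_box t l k v =
     (case positions_of_box (word_section t (canonical l) k) v of (i, j) \<Rightarrow>
        box_of_positions (canonical l) (i * int t + int k, j * int t + int k))"

end

theory Submission
  imports Defs
begin

text \<open>A word is determined by the positions of its zeros; for a partition these are the numbers
  \<open>\<lambda>_r - r + m\<close> with \<open>r = 0, 1, \<dots>\<close> (rows counted from 0 and
  padded with zeros), and the choice \<open>m = -1\<close> gives the canonical indexing.
  In a canonical word the side of the Durfee square is the number of ones at negative positions,
  and conjugation becomes \<open>c_i \<mapsto> 1 - c_{-1-i}\<close>. Hence for self-conjugate \<open>\<lambda>\<close> the box of a pair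
  \<open>(i, j)\<close> lies above, on or below the diagonal according to the sign of \<open>i + j + 1\<close>, which gives
  (ii) and (iii), because conjugation maps section \<open>k\<close> to section \<open>t - 1 - k\<close>.
  For (i), let \<open>d_k\<close> be the number of ones at negative positions of section \<open>k\<close>. Sorting keeps the
  difference \<open>d_k - d_{t-1-k}\<close> between ones at negative and zeros at nonnegative positions, so
  section \<open>k\<close> of the core has \<open>max 0 (d_k - d_{t-1-k})\<close> ones at negative positions. The sum of the
  two Durfee sides is therefore \<open>\<Sum>_k max d_k d_{t-1-k}\<close>, which is symmetric under
  \<open>k \<mapsto> t - 1 - k\<close>, so that modulo 2 only the middle section survives.\<close>


section \<open>Zeros of the word of a partition\<close>

definition part :: "nat list \<Rightarrow> nat \<Rightarrow> nat" where
  "part l r = (if r < length l then l ! r else 0)"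

text \<open>The beta-set (Maya diagram) of the partition. Padding rows contribute
  \<open>m - r\<close>, so the set is infinite to the left; the offset \<open>m\<close> records the
  choice of indexing.\<close>

definition beta :: "nat list \<Rightarrow> int \<Rightarrow> nat \<Rightarrow> int" where
  "beta l m r = int (part l r) - int r + m"

text \<open>Splits off row 0, so that prepending a bottom row to a partition becomes the insertion
  of one zero into the word.\<close>

lemma range_nat: "range f = insert (f (0::nat)) (range (\<lambda>r. f (Suc r)))"
  by (auto simp: image_iff) (metis not0_implies_Suc)

lemma part_Cons [simp]: "part (x # xs) 0 = x" "part (x # xs) (Suc r) = part xs r"
  by (auto simp: part_def)

lemma part_Nil [simp]: "part [] r = 0"
  by (simp add: part_def)

lemma is_partition_Nil [simp]: "is_partition []"
  by (simp add: is_partition_def)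

lemma is_partition_Cons:
  "is_partition (x # xs) \<longleftrightarrow> 0 < x \<and> part xs 0 \<le> x \<and> is_partition xs"
  by (cases xs) (auto simp: is_partition_def part_def)

lemma part_antimono:
  assumes "is_partition l" "r \<le> s"
  shows "part l s \<le> part l r"
  using assms
  by (cases "r = s") (auto simp: is_partition_def part_def sorted_wrt_iff_nth_less)

lemma beta_strict_antimono: "is_partition l \<Longrightarrow> r < s \<Longrightarrow> beta l m s < beta l m r"
  using part_antimono[of l r s] by (simp add: beta_def)

lemma beta_less_iff: "is_partition l \<Longrightarrow> beta l m s < beta l m r \<longleftrightarrow> r < s"
  by (metis beta_strict_antimono less_asym' linorder_neqE_nat)

lemma inj_beta: "is_partition l \<Longrightarrow> inj (beta l m)"
  by (metis beta_strict_antimono injI less_irrefl linorder_neqE_nat)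

lemma boxes_part: "(r, s) \<in> boxes l \<longleftrightarrow> 1 \<le> r \<and> 1 \<le> s \<and> s \<le> part l (r - 1)"
  by (auto simp: boxes_def part_def)

text \<open>Each row length is the largest column occurring in that row; as parts are positive, the
  number of rows is the first index with \<open>part l r = 0\<close>.\<close>

lemma boxes_inj:
  assumes "is_partition l" "is_partition l'" "boxes l = boxes l'"
  shows "l = l'"
proof -
  have eq: "part l r = part l' r" for r
  proof -
    have "1 \<le> s \<Longrightarrow> s \<le> part l r \<longleftrightarrow> s \<le> part l' r" for s
      using assms(3) boxes_part[of "Suc r" s l] boxes_part[of "Suc r" s l'] by simp
    from this[of "part l r"] this[of "part l' r"] show ?thesis by linarith
  qed
  have "part l r = 0 \<longleftrightarrow> length l \<le> r" if "is_partition l" for l r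
    using that by (auto simp: part_def is_partition_def dest: nth_mem)
  with eq assms(1,2) have "length l \<le> r \<longleftrightarrow> length l' \<le> r" for r by metis
  from this[of "length l"] this[of "length l'"] have len: "length l = length l'" by simp
  show ?thesis
    by (rule nth_equalityI[OF len]) (use eq len in \<open>metis part_def\<close>)
qed

lemma length_border: "is_partition l \<Longrightarrow> length (border l) = part l 0 + length l"
proof (induction l)
  case (Cons x xs)
  then show ?case by (cases xs) (auto simp: is_partition_Cons)
qed simp

text \<open>The bottom row is read last, and its horizontal edges agree with the ones that already
  end the word of \<open>xs\<close>. Only its vertical edge changes a letter.\<close>

lemma border_word_Cons:
  assumes "is_partition (x # xs)"
  shows "border_word (x # xs) = (border_word xs)(int (x + length xs) := False)"
proof
  fix i
  have p: "is_partition xs" "part xs 0 \<le> x" using assms by (auto simp: is_partition_Cons)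
  have len: "length (border xs) = part xs 0 + length xs" by (rule length_border[OF p(1)])
  have "border (x # xs) = border xs @ replicate (x - part xs 0) True @ [False]"
    by (cases xs) auto
  then have nth: "border (x # xs) ! n = (if n < part xs 0 + length xs then border xs ! n
      else n < x + length xs)" if "n \<le> x + length xs" for n
    using p(2) len that by (auto simp: nth_append nth_Cons split: nat.splits)
  show "border_word (x # xs) i = ((border_word xs)(int (x + length xs) := False)) i"
  proof (cases i)
    case (nonneg n)
    have "length (border (x # xs)) = Suc (x + length xs)"
      using length_border[OF assms] by simp
    then show ?thesis
      using nth[of n] p(2) len
      by (cases "n = x + length xs") (auto simp: border_word_def nonneg nat_int_add simp del: border.simps)
  next
    case (neg n)
    then show ?thesis by (simp add: border_word_def)
  qed
qed

text \<open>Induction from the top row downwards: a new bottom row raises the index of every older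
  row by one, and the offset \<open>length l - 1\<close> grows by one to compensate.\<close>

lemma zeros_border_word:
  "is_partition l \<Longrightarrow> {i. \<not> border_word l i} = range (beta l (int (length l) - 1))"
proof (induction l)
  case Nil
  have "i \<in> range (beta [] (-1))" if "i < 0" for i
    using that by (intro image_eqI[of _ _ "nat (-1 - i)"]) (auto simp: beta_def)
  then show ?case by (auto simp: border_word_def beta_def)
next
  case (Cons x xs)
  have "{i. \<not> border_word (x # xs) i} = insert (int (x + length xs)) {i. \<not> border_word xs i}"
    using border_word_Cons[OF Cons.prems] by auto
  also have "\<dots> = insert (int (x + length xs)) (range (beta xs (int (length xs) - 1)))"
    using Cons by (simp add: is_partition_Cons)
  also have "\<dots> = range (beta (x # xs) (int (length (x # xs)) - 1))"
  proof -
    have "beta (x # xs) (int (length (x # xs)) - 1) (Suc r) = beta xs (int (length xs) - 1) r" for r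
      by (simp add: beta_def)
    moreover have "beta (x # xs) (int (length (x # xs)) - 1) 0 = int (x + length xs)"
      by (simp add: beta_def)
    ultimately show ?thesis by (subst range_nat) simp
  qed
  finally show ?case .
qed

text \<open>Shifting the index by \<open>n\<close> only shifts the offset,
  \<open>m = length l - 1 - n\<close>; membership in \<open>psi l\<close> thus becomes a statement
  about sets of integers.\<close>

lemma psi_iff:
  assumes "is_partition l"
  shows "c \<in> psi l \<longleftrightarrow> (\<exists>m. {i. \<not> c i} = range (beta l m))"
proof
  assume "c \<in> psi l"
  then obtain n where n: "\<And>i. c i = border_word l (i + n)" by (auto simp: psi_def)
  have "\<not> c i \<longleftrightarrow> i \<in> range (beta l (int (length l) - 1 - n))" for i
  proof -
    have "\<not> c i \<longleftrightarrow> i + n \<in> range (beta l (int (length l) - 1))"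
      using zeros_border_word[OF assms] n by blast
    then show ?thesis by (auto simp: beta_def image_iff algebra_simps)
  qed
  then show "\<exists>m. {i. \<not> c i} = range (beta l m)" by blast
next
  assume "\<exists>m. {i. \<not> c i} = range (beta l m)"
  then obtain m where m: "{i. \<not> c i} = range (beta l m)" by blast
  define n where "n = int (length l) - 1 - m"
  have "c i = border_word l (i + n)" for i
  proof -
    have "\<not> c i \<longleftrightarrow> i \<in> range (beta l m)" using m by blast
    also have "\<dots> \<longleftrightarrow> i + n \<in> range (beta l (int (length l) - 1))"
      by (auto simp: beta_def image_iff n_def algebra_simps)
    also have "\<dots> \<longleftrightarrow> \<not> border_word l (i + n)" using zeros_border_word[OF assms] by blast
    finally show ?thesis by blast
  qed
  then show "c \<in> psi l" by (auto simp: psi_def)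
qed

section \<open>Finitary words and their charge\<close>

definition finitary :: "word \<Rightarrow> bool" where
  "finitary c \<longleftrightarrow> finite {i. i < 0 \<and> c i} \<and> finite {i. 0 \<le> i \<and> \<not> c i}"

text \<open>The charge of a Maya diagram. It vanishes exactly for the canonical indexing, is
  invariant under swaps and is additive over sections.\<close>

definition charge :: "word \<Rightarrow> int" where
  "charge c = int (card {i. 0 \<le> i \<and> \<not> c i}) - int (card {i. i < 0 \<and> c i})"

lemma finitary_bound:
  assumes "finitary c"
  obtains N where "N \<le> 0" "\<forall>i<N. \<not> c i" "finite {i. N \<le> i \<and> \<not> c i}"
proof -
  define N where "N = Min (insert 0 {i. i < 0 \<and> c i})"
  have fin: "finite (insert 0 {i. i < 0 \<and> c i})" using assms by (simp add: finitary_def)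
  have N0: "N \<le> 0" unfolding N_def using fin by (intro Min_le) auto
  have "\<not> c i" if "i < N" for i
  proof
    assume "c i"
    then have "N \<le> i" unfolding N_def using that N0 fin by (intro Min_le) auto
    then show False using that by simp
  qed
  moreover have "finite {i. N \<le> i \<and> \<not> c i}"
    by (rule finite_subset[of _ "{N..0} \<union> {i. 0 \<le> i \<and> \<not> c i}"])
      (use assms in \<open>auto simp: finitary_def\<close>)
  ultimately show ?thesis using that N0 by blast
qed

text \<open>The charge may be read off at any origin \<open>N\<close> left of all ones.\<close>

lemma finitary_charge_bound:
  assumes "N \<le> 0" "\<forall>i<N. \<not> c i" "finite {i. N \<le> i \<and> \<not> c i}"
  shows "finitary c" "charge c = int (card {i. N \<le> i \<and> \<not> c i}) + N"
proof -
  have f1: "finite {i. i < 0 \<and> c i}"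
    by (rule finite_subset[of _ "{N..0}"]) (use assms(2) in force)+
  have f2: "finite {i. 0 \<le> i \<and> \<not> c i}"
    by (rule finite_subset[OF _ assms(3)]) (use assms(1) in auto)
  show "finitary c" using f1 f2 by (simp add: finitary_def)
  have f3: "finite {i. N \<le> i \<and> i < 0 \<and> \<not> c i}"
    by (rule finite_subset[OF _ assms(3)]) auto
  have "{i. N \<le> i \<and> \<not> c i} = {i. N \<le> i \<and> i < 0 \<and> \<not> c i} \<union> {i. 0 \<le> i \<and> \<not> c i}"
    using assms(1) by auto
  then have 1: "card {i. N \<le> i \<and> \<not> c i}
      = card {i. N \<le> i \<and> i < 0 \<and> \<not> c i} + card {i. 0 \<le> i \<and> \<not> c i}"
    using f2 f3 by (subst card_Un_disjoint[symmetric]) auto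
  \<comment> \<open>The \<open>- N\<close> positions from \<open>N\<close> to \<open>-1\<close> hold
    all the negative ones, so the zeros among them number \<open>- N\<close> minus these
    ones.\<close>
  have "{N..<0} = {i. N \<le> i \<and> i < 0 \<and> \<not> c i} \<union> {i. i < 0 \<and> c i}"
    using assms(2) by force
  then have "card {N..<0} = card {i. N \<le> i \<and> i < 0 \<and> \<not> c i} + card {i. i < 0 \<and> c i}"
    using f1 f3 by (subst card_Un_disjoint[symmetric]) auto
  then have "- N = int (card {i. N \<le> i \<and> i < 0 \<and> \<not> c i} + card {i. i < 0 \<and> c i})"
    using assms(1) by (metis card_atLeastLessThan_int diff_0 int_nat_eq neg_0_le_iff_le)
  then show "charge c = int (card {i. N \<le> i \<and> \<not> c i}) + N"
    unfolding charge_def using 1 by linarith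
qed

lemma psi_finitary_charge:
  assumes "is_partition l" "{i. \<not> c i} = range (beta l m)"
  shows "finitary c" "charge c = m + 1"
proof -
  \<comment> \<open>The summand \<open>length l\<close> puts row \<open>R\<close> into the padding,
    and \<open>nat (m + 1)\<close> ensures \<open>N \<le> 0\<close>. The zero of row
    \<open>R\<close> is at \<open>N - 1\<close>, so exactly the rows below index \<open>R\<close>
    have their zeros from \<open>N\<close> on, and the charge is
    \<open>R + N = m + 1\<close>.\<close>
  define R where "R = length l + nat (m + 1)"
  define N where "N = m - int R + 1"
  have low: "\<forall>i<N. \<not> c i"
  proof (intro allI impI)
    fix i assume that: "i < N"
    have "length l \<le> nat (m - i)" "i \<le> m" using that unfolding N_def R_def by arith+
    then have "i = beta l m (nat (m - i))" by (simp add: beta_def part_def)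
    then show "\<not> c i" using assms(2) by blast
  qed
  have "beta l m R = N - 1" by (simp add: beta_def part_def N_def R_def)
  then have "N \<le> beta l m r \<longleftrightarrow> r < R" for r
    using beta_less_iff[OF assms(1), of m R r] by auto
  moreover have "\<not> c i \<longleftrightarrow> i \<in> range (beta l m)" for i using assms(2) by blast
  ultimately have eq: "{i. N \<le> i \<and> \<not> c i} = beta l m ` {..<R}" by auto
  then have card: "card {i. N \<le> i \<and> \<not> c i} = R"
    using inj_beta[OF assms(1)] by (simp add: card_image inj_on_def)
  have "N \<le> 0" by (simp add: N_def R_def)
  note * = finitary_charge_bound[OF this low]
  show "finitary c" "charge c = m + 1"
    using * eq card by (auto simp: N_def)
qed

text \<open>Beyond the all-zero half-line only finitely many zeros remain; inserting them in
  increasing order builds the partition row by row from the top.\<close>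

lemma psi_exists:
  assumes "finitary c"
  shows "\<exists>l. is_partition l \<and> c \<in> psi l"
proof -
  obtain N where N: "N \<le> 0" "\<forall>i<N. \<not> c i" "finite {i. N \<le> i \<and> \<not> c i}"
    using finitary_bound[OF assms] by blast
  have "\<exists>l m. is_partition l \<and> {..<N} \<union> F = range (beta l m)" if "finite F" "F \<subseteq> {N..}" for F
    using that
  proof (induction F rule: finite_linorder_max_induct)
    case empty
    have "i \<in> range (beta [] (N - 1))" if "i < N" for i
      using that by (intro image_eqI[of _ _ "nat (N - 1 - i)"]) (auto simp: beta_def)
    then have "{..<N} \<union> {} = range (beta [] (N - 1))" by (auto simp: beta_def)
    then show ?case by (intro exI[of _ "[]"] exI[of _ "N - 1"]) simp
  next
    case (insert b F)
    then obtain l m where l: "is_partition l" "{..<N} \<union> F = range (beta l m)" by auto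
    have "beta l m 0 \<in> {..<N} \<union> F" using l(2) by blast
    then have less: "beta l m 0 < b" using insert by auto
    then have b: "b = beta (nat (b - (m + 1)) # l) (m + 1) 0" by (simp add: beta_def)
    show ?case
    proof (cases "b = m + 1")
      \<comment> \<open>A zero at \<open>m + 1\<close> would give a row of length 0. Then no earlier
        row is nonempty either, and only the offset moves.\<close>
      case True
      then have "part l 0 = 0" using less by (simp add: beta_def)
      then have "l = []" using l(1) by (cases l) (auto simp: is_partition_Cons)
      moreover have "range (beta [] (m + 1)) = insert b (range (beta [] m))"
        by (subst range_nat) (simp add: beta_def True)
      ultimately show ?thesis using l by (intro exI[of _ "[]"] exI[of _ "m + 1"]) auto
    next
      case False
      let ?l = "nat (b - (m + 1)) # l"
      have "is_partition ?l"
        using l(1) less False by (auto simp: is_partition_Cons beta_def)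
      moreover have "range (beta ?l (m + 1)) = insert b (range (beta l m))"
        by (subst range_nat, subst b[symmetric]) (simp add: beta_def algebra_simps)
      ultimately show ?thesis using l(2)
        by (intro exI[of _ ?l] exI[of _ "m + 1"]) auto
    qed
  qed
  from this[OF N(3)] obtain l m where l: "is_partition l"
    "{..<N} \<union> {i. N \<le> i \<and> \<not> c i} = range (beta l m)" by auto
  moreover have "{..<N} \<union> {i. N \<le> i \<and> \<not> c i} = {i. \<not> c i}" using N(2) by auto
  ultimately show ?thesis by (metis psi_iff)
qed

section \<open>Boxes as pairs of positions\<close>

lemma finite_ones_le: "finitary c \<Longrightarrow> finite {x. x \<le> i \<and> c x}"
  by (rule finite_subset[of _ "{x. x < 0 \<and> c x} \<union> {0..i}"]) (auto simp: finitary_def)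

lemma finite_zeros_ge: "finitary c \<Longrightarrow> finite {x. i \<le> x \<and> \<not> c x}"
  by (rule finite_subset[of _ "{x. 0 \<le> x \<and> \<not> c x} \<union> {i..0}"]) (auto simp: finitary_def)

lemma card_ones_less:
  "finitary c \<Longrightarrow> i < i' \<Longrightarrow> c i' \<Longrightarrow> card {x. x \<le> i \<and> c x} < card {x. x \<le> i' \<and> c x}"
  by (intro psubset_card_mono finite_ones_le psubsetI) (auto simp: set_eq_iff intro!: exI[of _ i'])

lemma card_zeros_less:
  "finitary c \<Longrightarrow> j < j' \<Longrightarrow> \<not> c j \<Longrightarrow> card {x. j' \<le> x \<and> \<not> c x} < card {x. j \<le> x \<and> \<not> c x}"
  by (intro psubset_card_mono finite_zeros_ge psubsetI) (auto simp: set_eq_iff intro!: exI[of _ j])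

lemma ex_rank:
  fixes S :: "int set"
  assumes "finite S" "1 \<le> s" "s \<le> card S"
  shows "\<exists>i\<in>S. card {x \<in> S. x \<le> i} = s"
  using assms
proof (induction S rule: finite_linorder_max_induct)
  case (insert b S)
  have b: "b \<notin> S" using insert by auto
  show ?case
  proof (cases "s \<le> card S")
    case True
    then obtain i where i: "i \<in> S" "card {x \<in> S. x \<le> i} = s" using insert by blast
    have "{x \<in> insert b S. x \<le> i} = {x \<in> S. x \<le> i}" using i(1) insert.hyps(2) by auto
    then show ?thesis using i by (metis insertI2)
  next
    case False
    then have s: "s = card (insert b S)" using insert b by simp
    have "{x \<in> insert b S. x \<le> b} = insert b S" using insert.hyps(2) by auto
    then show ?thesis using s by auto
  qed
qed simp

lemma ex_one_rank:
  assumes "finitary c" "1 \<le> s" "s \<le> card {x. x < n \<and> c x}"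
  obtains i where "i < n" "c i" "card {x. x \<le> i \<and> c x} = s"
proof -
  have "finite {x. x < n \<and> c x}"
    by (rule finite_subset[OF _ finite_ones_le[OF assms(1), of n]]) auto
  then obtain i where i: "i < n" "c i" "card {x \<in> {x. x < n \<and> c x}. x \<le> i} = s"
    using ex_rank[OF _ assms(2,3)] by auto
  moreover have "{x \<in> {x. x < n \<and> c x}. x \<le> i} = {x. x \<le> i \<and> c x}" using i(1) by auto
  ultimately show ?thesis using that by simp
qed

section \<open>Conjugation as reflection of words\<close>

text \<open>Reflecting the diagram reverses its border and exchanges the two kinds of edges. The
  centre is -1/2, not 0, so that negative and nonnegative positions change places.\<close>

definition dual :: "word \<Rightarrow> word" where
  "dual c i = (\<not> c (- 1 - i))"

lemma dual_dual [simp]: "dual (dual c) = c"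
  by (auto simp: dual_def)

lemma card_dual_le: "card {x. x \<le> i \<and> dual c x} = card {x. - 1 - i \<le> x \<and> \<not> c x}"
  by (rule bij_betw_same_card[of "\<lambda>x. - 1 - x"], rule bij_betw_byWitness[where f' = "\<lambda>x. - 1 - x"])
    (auto simp: dual_def)

lemma card_dual_ge: "card {x. i \<le> x \<and> \<not> dual c x} = card {x. x \<le> - 1 - i \<and> c x}"
  by (rule bij_betw_same_card[of "\<lambda>x. - 1 - x"], rule bij_betw_byWitness[where f' = "\<lambda>x. - 1 - x"])
    (auto simp: dual_def)

lemma card_dual_neg: "card {x. x < 0 \<and> dual c x} = card {x. 0 \<le> x \<and> \<not> c x}"
proof -
  have "{x. x < 0 \<and> dual c x} = {x. x \<le> -1 \<and> dual c x}" by auto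
  then show ?thesis using card_dual_le[of "-1" c] by simp
qed

lemma finitary_dual:
  assumes "finitary c"
  shows "finitary (dual c)"
proof -
  have "bij_betw (\<lambda>x. - 1 - x) {x. 0 \<le> x \<and> \<not> c x} {x. x < 0 \<and> dual c x}"
    "bij_betw (\<lambda>x. - 1 - x) {x. x < 0 \<and> c x} {x. 0 \<le> x \<and> \<not> dual c x}"
    by (rule bij_betw_byWitness[where f' = "\<lambda>x. - 1 - x"]; auto simp: dual_def)+
  from this[THEN bij_betw_finite] show ?thesis
    using assms by (simp add: finitary_def)
qed

section \<open>Reading the boxes off the word\<close>

lemma box_corresp_iff:
  "box_corresp c (i, j) (r, s) \<longleftrightarrow> i < j \<and> c i \<and> \<not> c j
     \<and> card {x. x \<le> i \<and> c x} = s \<and> card {x. j \<le> x \<and> \<not> c x} = r"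
  by (simp add: box_corresp_def)

text \<open>The reflection exchanges counting ones from the left with counting zeros from the right,
  hence columns with rows.\<close>

lemma box_corresp_dual:
  "box_corresp (dual c) (i, j) (r, s) \<longleftrightarrow> box_corresp c (- 1 - j, - 1 - i) (s, r)"
  unfolding box_corresp_iff card_dual_le card_dual_ge by (auto simp: dual_def)

text \<open>The rank from the left is strictly increasing along ones and the rank from the right
  strictly decreasing along zeros, so each coordinate fixes one position.\<close>

lemma box_corresp_unique:
  assumes "finitary c" "box_corresp c p v" "box_corresp c q v"
  shows "p = q"
proof -
  obtain i j i' j' r s where [simp]: "p = (i, j)" "q = (i', j')" "v = (r, s)"
    by (metis surj_pair)
  have "i = i'"
    using assms(2,3) card_ones_less[OF assms(1), of i i'] card_ones_less[OF assms(1), of i' i]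
    by (cases i i' rule: linorder_cases) (simp_all add: box_corresp_iff)
  moreover have "j = j'"
    using assms(2,3) card_zeros_less[OF assms(1), of j j'] card_zeros_less[OF assms(1), of j' j]
    by (cases j j' rule: linorder_cases) (simp_all add: box_corresp_iff)
  ultimately show ?thesis by simp
qed

lemma positions_of_box_eq:
  "finitary c \<Longrightarrow> box_corresp c p v \<Longrightarrow> positions_of_box c v = p"
  unfolding positions_of_box_def by (blast intro: box_corresp_unique)

lemma box_of_positions_eq:
  "i < j \<Longrightarrow> c i \<Longrightarrow> \<not> c j \<Longrightarrow>
     box_of_positions c (i, j) = (card {x. j \<le> x \<and> \<not> c x}, card {x. x \<le> i \<and> c x})"
  unfolding box_of_positions_def by (rule the_equality) (auto simp: box_corresp_def)

text \<open>As \<open>beta\<close> decreases strictly, the zeros counted are those of rows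
  \<open>0\<close> to \<open>r\<close>; the value \<open>Suc r\<close> is the row number counted
  from 1.\<close>

lemma card_zeros_beta:
  assumes "is_partition l" "{i. \<not> c i} = range (beta l m)"
  shows "card {x. beta l m r \<le> x \<and> \<not> c x} = Suc r"
proof -
  have "\<not> c i \<longleftrightarrow> i \<in> range (beta l m)" for i using assms(2) by blast
  moreover have "beta l m r \<le> beta l m q \<longleftrightarrow> q \<le> r" for q
    using beta_less_iff[OF assms(1), of m q r] by (meson not_le)
  ultimately have "{x. beta l m r \<le> x \<and> \<not> c x} = beta l m ` {..r}" by auto
  then show ?thesis using inj_beta[OF assms(1)] by (simp add: card_image inj_on_def)
qed

text \<open>All ones lie to the right of \<open>N\<close>, the zero of a padding row
  \<open>R\<close>. Removing from \<open>{N<..<beta l m r}\<close> the \<open>R - Suc r\<close>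
  zeros of the rows strictly between \<open>r\<close> and \<open>R\<close> leaves
  \<open>part l r\<close> positions.\<close>

lemma card_ones_beta:
  assumes "is_partition l" "{i. \<not> c i} = range (beta l m)"
  shows "card {x. x < beta l m r \<and> c x} = part l r"
proof -
  define R where "R = Suc (length l + r)"
  define N where "N = m - int R"
  have z: "\<not> c i \<longleftrightarrow> i \<in> range (beta l m)" for i using assms(2) by blast
  have N: "N = beta l m R" by (simp add: N_def R_def beta_def part_def)
  have low: "\<not> c i" if "i \<le> N" for i
  proof -
    have "length l \<le> nat (m - i)" "i \<le> m" using that by (auto simp: N_def R_def)
    then have "i = beta l m (nat (m - i))" by (simp add: beta_def part_def)
    then show ?thesis using z by blast
  qed
  have betw: "beta l m ` {r<..<R} = {x. N < x \<and> x < beta l m r \<and> \<not> c x}"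
    unfolding z N by (auto simp: beta_less_iff[OF assms(1)])
  have "N < x" if "c x" for x using low that by (meson not_le)
  then have "{N<..<beta l m r} = {x. x < beta l m r \<and> c x} \<union> beta l m ` {r<..<R}"
    unfolding betw by auto
  moreover have "finite {x. x < beta l m r \<and> c x}"
    by (rule finite_subset[OF _ finite_ones_le[OF psi_finitary_charge(1)[OF assms], of "beta l m r"]])
      auto
  moreover have "card (beta l m ` {r<..<R}) = R - Suc r"
    using inj_beta[OF assms(1)] by (simp add: card_image inj_on_def)
  moreover have "{x. x < beta l m r \<and> c x} \<inter> beta l m ` {r<..<R} = {}"
    unfolding betw by blast
  ultimately have "card {N<..<beta l m r} = card {x. x < beta l m r \<and> c x} + (R - Suc r)"
    by (simp add: card_Un_disjoint)
  then show ?thesis by (simp add: N_def R_def beta_def)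
qed

text \<open>A row has as many boxes as there are ones to the left of its zero, so its box in column
  \<open>s\<close> is the pairing of this zero with the \<open>s\<close>-th one.\<close>

lemma boxes_iff:
  assumes "is_partition l" "c \<in> psi l"
  shows "v \<in> boxes l \<longleftrightarrow> (\<exists>p. box_corresp c p v)"
proof -
  obtain r s where v: "v = (r, s)" by force
  obtain m where m: "{i. \<not> c i} = range (beta l m)" using assms psi_iff by blast
  have fin: "finitary c" using psi_finitary_charge[OF assms(1) m] by blast
  have z: "\<not> c i \<longleftrightarrow> i \<in> range (beta l m)" for i using m by blast
  note ones = card_ones_beta[OF assms(1) m] and zeros = card_zeros_beta[OF assms(1) m]
  show ?thesis
  proof
    assume "v \<in> boxes l"
    then have rs: "1 \<le> r" "1 \<le> s" "s \<le> part l (r - 1)" by (auto simp: v boxes_part)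
    then obtain i where "i < beta l m (r - 1)" "c i" "card {x. x \<le> i \<and> c x} = s"
      using ex_one_rank[OF fin rs(2), of "beta l m (r - 1)"] ones by metis
    then have "box_corresp c (i, beta l m (r - 1)) v"
      using rs(1) zeros[of "r - 1"] z[of "beta l m (r - 1)"] by (simp add: v box_corresp_iff)
    then show "\<exists>p. box_corresp c p v" by blast
  next
    assume "\<exists>p. box_corresp c p v"
    then obtain i j where b: "i < j" "c i" "\<not> c j" "card {x. x \<le> i \<and> c x} = s"
      "card {x. j \<le> x \<and> \<not> c x} = r" by (auto simp: v box_corresp_iff)
    then obtain q where q: "j = beta l m q" using z by blast
    have fin': "finite {x. x < j \<and> c x}"
      by (rule finite_subset[OF _ finite_ones_le[OF fin, of j]]) auto
    have "s \<le> part l q"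
      unfolding b(4)[symmetric] ones[of q, symmetric] q[symmetric]
      using b(1) by (intro card_mono fin') auto
    moreover have "s \<noteq> 0"
      using b(2) finite_ones_le[OF fin, of i] unfolding b(4)[symmetric] by (auto simp: card_eq_0_iff)
    ultimately show "v \<in> boxes l" using b(5) zeros[of q] q by (auto simp: v boxes_part)
  qed
qed

section \<open>Uniqueness of the partition and the canonical indexing\<close>

text \<open>By \<open>boxes_iff\<close> the set of boxes depends on the word alone, and it
  determines the partition.\<close>

lemma psi_unique:
  "is_partition l \<Longrightarrow> is_partition l' \<Longrightarrow> c \<in> psi l \<Longrightarrow> c \<in> psi l' \<Longrightarrow> l = l'"
  by (intro boxes_inj set_eqI) (simp_all add: boxes_iff[of l c] boxes_iff[of l' c])

lemma psi_inv_eq: "is_partition l \<Longrightarrow> c \<in> psi l \<Longrightarrow> psi_inv c = l"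
  unfolding psi_inv_def by (blast intro: psi_unique)

lemma psi_inv:
  assumes "finitary c"
  shows "is_partition (psi_inv c)" "c \<in> psi (psi_inv c)"
  using psi_exists[OF assms] psi_inv_eq by metis+

lemma charge_eq_0_iff: "charge c = 0 \<longleftrightarrow> card {i. i \<le> - 1 \<and> c i} = card {i. 0 \<le> i \<and> \<not> c i}"
proof -
  have "{i. i < 0 \<and> c i} = {i. i \<le> - 1 \<and> c i}" by auto
  then show ?thesis unfolding charge_def by simp linarith
qed

text \<open>The charge of an indexing with offset \<open>m\<close> is \<open>m + 1\<close>, so
  charge 0 forces \<open>m = -1\<close>.\<close>

lemma psi_charge_0_unique:
  assumes "is_partition l" "c \<in> psi l" "charge c = 0" "d \<in> psi l" "charge d = 0"
  shows "c = d"
proof -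
  have "{i. \<not> c i} = range (beta l (-1))" if cd: "c \<in> psi l" "charge c = 0" for c
  proof -
    obtain m where m: "{i. \<not> c i} = range (beta l m)"
      using cd(1) unfolding psi_iff[OF assms(1)] by blast
    have "m = -1" using psi_finitary_charge(2)[OF assms(1) m] cd(2) by linarith
    then show ?thesis using m by (simp only:)
  qed
  from this[OF assms(2,3)] this[OF assms(4,5)] have "{i. \<not> c i} = {i. \<not> d i}"
    by (simp only:)
  then show ?thesis by (simp add: set_eq_iff fun_eq_iff)
qed

lemma canonical_eqI:
  assumes "is_partition l" "c \<in> psi l" "charge c = 0"
  shows "canonical l = c"
  unfolding canonical_def charge_eq_0_iff[symmetric]
  using assms psi_charge_0_unique[OF assms(1)] by (intro the_equality conjI) blast+

lemma canonical:
  assumes "is_partition l"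
  shows "canonical l \<in> psi l" "charge (canonical l) = 0" "finitary (canonical l)"
proof -
  define c where "c i \<longleftrightarrow> i \<notin> range (beta l (-1))" for i
  have z: "{i. \<not> c i} = range (beta l (-1))" by (auto simp: c_def)
  have "charge c = 0" "finitary c" using psi_finitary_charge[OF assms z] by auto
  moreover have "c \<in> psi l" using psi_iff[OF assms] z by blast
  moreover from this have "canonical l = c" by (rule canonical_eqI[OF assms]) fact
  ultimately show "canonical l \<in> psi l" "charge (canonical l) = 0" "finitary (canonical l)"
    by simp_all
qed

lemma canonical_psi_inv: "finitary c \<Longrightarrow> charge c = 0 \<Longrightarrow> canonical (psi_inv c) = c"
  by (simp add: canonical_eqI psi_inv)

lemma canonical_inj:
  "is_partition l \<Longrightarrow> is_partition l' \<Longrightarrow> canonical l = canonical l' \<Longrightarrow> l = l'"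
  by (metis canonical(1) psi_unique)

text \<open>The dual word again has charge 0 and its boxes are the transposed ones, so it is the
  canonical word of the conjugate, which is \<open>l\<close> itself.\<close>

lemma dual_canonical:
  assumes "is_partition l" "self_conjugate l"
  shows "dual (canonical l) = canonical l"
proof -
  let ?c = "canonical l"
  have neg: "card {x. x < 0 \<and> dual ?c x} = card {x. 0 \<le> x \<and> \<not> ?c x}"
    by (rule card_dual_neg)
  have pos: "card {x. 0 \<le> x \<and> \<not> dual ?c x} = card {x. x < 0 \<and> ?c x}"
    using card_dual_neg[of "dual ?c"] by simp
  have charge: "charge (dual ?c) = 0"
    using canonical(2)[OF assms(1)] by (simp add: charge_def neg pos)
  have fin: "finitary (dual ?c)" by (rule finitary_dual[OF canonical(3)[OF assms(1)]])
  obtain l' where l': "is_partition l'" "dual ?c \<in> psi l'" using psi_exists[OF fin] by blast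
  have "(r, s) \<in> boxes l' \<longleftrightarrow> (s, r) \<in> boxes l" for r s
    unfolding boxes_iff[OF l'] boxes_iff[OF assms(1) canonical(1)[OF assms(1)]] split_paired_Ex
      box_corresp_dual
    by (metis diff_diff_eq2 add_diff_cancel_left')
  then have "boxes l' = prod.swap ` boxes l" by (force simp: image_iff)
  also have "\<dots> = boxes l"
    using boxes_conjugate[OF assms(1)] assms(2) by (simp add: self_conjugate_def)
  finally have "l' = l" by (rule boxes_inj[OF l'(1) assms(1)])
  then show ?thesis using canonical_eqI[OF assms(1) _ charge] l'(2) by simp
qed

section \<open>Diagonal and Durfee square in terms of positions\<close>

lemma charge_dual_eq_0: "dual c = c \<Longrightarrow> charge c = 0"
  using card_dual_neg[of c] by (simp add: charge_def)

text \<open>Self-duality turns the number of ones up to \<open>i\<close> into the number of zeros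
  from \<open>- 1 - i\<close> on. Comparing column and row then compares two tail counts of zeros,
  that is, the positions \<open>- 1 - i\<close> and \<open>j\<close>, both of which carry
  zeros.\<close>

lemma above_dual:
  assumes "finitary c" "dual c = c" "c i" "\<not> c j"
  shows "card {x. x \<le> i \<and> c x} < card {x. j \<le> x \<and> \<not> c x} \<longleftrightarrow> i + j + 1 < 0"
    and "card {x. j \<le> x \<and> \<not> c x} < card {x. x \<le> i \<and> c x} \<longleftrightarrow> 0 < i + j + 1"
proof -
  have i: "\<not> c (- 1 - i)" using assms(2,3) by (metis dual_def)
  have eq: "card {x. x \<le> i \<and> c x} = card {x. - 1 - i \<le> x \<and> \<not> c x}"
    using card_dual_le[of i c] assms(2) by simp
  show "card {x. x \<le> i \<and> c x} < card {x. j \<le> x \<and> \<not> c x} \<longleftrightarrow> i + j + 1 < 0"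
    "card {x. j \<le> x \<and> \<not> c x} < card {x. x \<le> i \<and> c x} \<longleftrightarrow> 0 < i + j + 1"
    unfolding eq
    using card_zeros_less[OF assms(1) _ i, of j] card_zeros_less[OF assms(1) _ assms(4), of "- 1 - i"]
    by (cases j "- 1 - i" rule: linorder_cases; auto)+
qed

text \<open>A square of side \<open>d > 0\<close> fits exactly when the box \<open>(d, d)\<close>
  exists, and charge 0 gives as many nonnegative zeros as negative ones to build diagonal boxes
  from.\<close>

lemma durfee_eq:
  assumes "is_partition l"
  shows "durfee l = card {i. i < 0 \<and> canonical l i}"
proof -
  let ?c = "canonical l"
  define D where "D = card {i. i < 0 \<and> ?c i}"
  have fin: "finitary ?c" by (rule canonical(3)[OF assms])
  have neg: "card {i. i \<le> - 1 \<and> ?c i} = D"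
  proof -
    have "{i. i < 0 \<and> ?c i} = {i. i \<le> - 1 \<and> ?c i}" by auto
    then show ?thesis unfolding D_def by (simp only:)
  qed
  then have pos: "card {i. 0 \<le> i \<and> \<not> ?c i} = D"
    using canonical(2)[OF assms] charge_eq_0_iff by simp
  have sq: "(\<exists>a b. {a<..a + d} \<times> {b<..b + d} \<subseteq> boxes l) \<longleftrightarrow> d = 0 \<or> (d, d) \<in> boxes l" for d
  proof
    \<comment> \<open>The square may sit anywhere; its far corner together with the monotonicity of
      the rows yields the box \<open>(d, d)\<close>.\<close>
    assume "\<exists>a b. {a<..a + d} \<times> {b<..b + d} \<subseteq> boxes l"
    then obtain a b where "{a<..a + d} \<times> {b<..b + d} \<subseteq> boxes l" by blast
    moreover have "(a + d, b + d) \<in> {a<..a + d} \<times> {b<..b + d}" if "d \<noteq> 0" using that by simp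
    ultimately have "d = 0 \<or> (a + d, b + d) \<in> boxes l" by blast
    then show "d = 0 \<or> (d, d) \<in> boxes l"
      using part_antimono[OF assms, of "d - 1" "a + d - 1"] unfolding boxes_part by linarith
  next
    assume *: "d = 0 \<or> (d, d) \<in> boxes l"
    have "{0<..0 + d} \<times> {0<..0 + d} \<subseteq> boxes l"
    proof clarify
      fix r s assume rs: "r \<in> {0<..0 + d}" "s \<in> {0<..0 + d}"
      then show "(r, s) \<in> boxes l"
        using * part_antimono[OF assms, of "r - 1" "d - 1"]
        unfolding boxes_part greaterThanAtMost_iff by linarith
    qed
    then show "\<exists>a b. {a<..a + d} \<times> {b<..b + d} \<subseteq> boxes l" by blast
  qed
  have diag: "d = 0 \<or> (d, d) \<in> boxes l \<longleftrightarrow> d \<le> D" for d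
  proof
    assume "d = 0 \<or> (d, d) \<in> boxes l"
    \<comment> \<open>With ranks beyond \<open>D\<close>, the one would be at a nonnegative and the
      zero at a negative position, against \<open>i < j\<close>.\<close>
    moreover have False if d: "(d, d) \<in> boxes l" "D < d"
    proof -
      obtain i j where ij: "i < j" "card {x. x \<le> i \<and> ?c x} = d" "card {x. j \<le> x \<and> \<not> ?c x} = d"
        using d(1) boxes_iff[OF assms canonical(1)[OF assms]] by (auto simp: box_corresp_iff)
      have "card {x. x \<le> i \<and> ?c x} \<le> card {x. x \<le> - 1 \<and> ?c x}" if "i \<le> - 1"
        using that by (intro card_mono finite_ones_le[OF fin]) auto
      then have "\<not> i \<le> - 1" using ij(2) neg d(2) by linarith
      moreover have "card {x. j \<le> x \<and> \<not> ?c x} \<le> card {x. 0 \<le> x \<and> \<not> ?c x}" if "0 \<le> j"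
        using that by (intro card_mono finite_zeros_ge[OF fin]) auto
      then have "\<not> 0 \<le> j" using ij(3) pos d(2) by linarith
      ultimately show False using ij(1) by linarith
    qed
    ultimately show "d \<le> D" by force
  next
    assume d: "d \<le> D"
    show "d = 0 \<or> (d, d) \<in> boxes l"
    proof (cases "d = 0")
      case False
      have "D = card {i. i < 0 \<and> ?c i}" by (rule D_def)
      then obtain i where i: "i < 0" "?c i" "card {x. x \<le> i \<and> ?c x} = d"
        using ex_one_rank[OF fin, of d 0] d False by (metis less_one not_le)
      \<comment> \<open>The \<open>d\<close>-th zero from the right is found as the
        \<open>d\<close>-th one from the left of the dual word.\<close>
      have "finitary (dual ?c)"
        using fin by (rule finitary_dual)
      then obtain j' where j': "j' < 0" "dual ?c j'" "card {x. x \<le> j' \<and> dual ?c x} = d"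
        using ex_one_rank[of "dual ?c" d 0] d False card_dual_neg[of ?c] pos
        by (metis less_one not_le)
      have "card {x. - 1 - j' \<le> x \<and> \<not> ?c x} = d" using j'(3) unfolding card_dual_le .
      then have "box_corresp ?c (i, - 1 - j') (d, d)"
        using i j'(1,2) by (auto simp: box_corresp_iff dual_def)
      then show ?thesis using boxes_iff[OF assms canonical(1)[OF assms]] by blast
    qed simp
  qed
  have "durfee l = Max {d. d \<le> D}" unfolding durfee_def sq diag ..
  also have "\<dots> = D" by (rule Max_eqI) auto
  finally show ?thesis by (simp add: D_def)
qed

section \<open>Sections and cores\<close>

lemma residue_Union:
  assumes "0 < t"
  shows "{x. P x} = (\<Union>k<t. (\<lambda>i. i * int t + int k) ` {i. P (i * int t + int k)})"
proof (intro set_eqI iffI)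
  fix x assume x: "x \<in> {x. P x}"
  have "(x div int t) * int t + int (nat (x mod int t)) = x" using assms by simp
  then show "x \<in> (\<Union>k<t. (\<lambda>i. i * int t + int k) ` {i. P (i * int t + int k)})"
    using assms x
    by (intro UN_I[of "nat (x mod int t)"] image_eqI[of _ _ "x div int t"])
      (simp_all add: nat_less_iff)
qed auto

lemma inj_residue: "0 < t \<Longrightarrow> inj (\<lambda>i. i * int t + int k)"
  by (auto simp: inj_def)

lemma finite_residues:
  assumes "0 < t"
  shows "finite {x. P x} \<longleftrightarrow> (\<forall>k<t. finite {i. P (i * int t + int k)})"
  by (subst residue_Union[OF assms])
    (auto simp: finite_image_iff inj_on_subset[OF inj_residue[OF assms]])

lemma card_residues:
  assumes "0 < t" "finite {x. P x}"
  shows "card {x. P x} = (\<Sum>k<t. card {i. P (i * int t + int k)})"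
proof -
  have disj: "k = k'" if "i * int t + int k = i' * int t + int k'" "k < t" "k' < t" for i i' k k'
    using arg_cong[OF that(1), of "\<lambda>x. x mod int t"] that(2,3) by simp
  have fin: "\<forall>k<t. finite {i. P (i * int t + int k)}"
    using assms finite_residues by blast
  have "card {x. P x} = card (\<Union>k<t. (\<lambda>i. i * int t + int k) ` {i. P (i * int t + int k)})"
    by (subst residue_Union[OF assms(1)]) (rule refl)
  also have "\<dots> = (\<Sum>k<t. card ((\<lambda>i. i * int t + int k) ` {i. P (i * int t + int k)}))"
    by (rule card_UN_disjoint) (use fin disj in \<open>auto 0 3\<close>)
  also have "\<dots> = (\<Sum>k<t. card {i. P (i * int t + int k)})"
    by (intro sum.cong refl card_image inj_on_subset[OF inj_residue[OF assms(1)]]) auto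
  finally show ?thesis .
qed

text \<open>A remainder \<open>k < t\<close> cannot carry a negative multiple of \<open>t\<close> up
  to 0. Hence the origin of the whole word serves as origin of every section.\<close>

lemma residue_neg_iff: "k < t \<Longrightarrow> i * int t + int k < 0 \<longleftrightarrow> i < 0"
proof
  assume k: "k < t"
  { assume "i * int t + int k < 0"
    then have "i * int t < 0" by linarith
    then show "i < 0" by (simp add: mult_less_0_iff) }
  assume "i < 0"
  then have "(i + 1) * int t \<le> 0" by (intro mult_nonpos_nonneg) auto
  then show "i * int t + int k < 0" using k by (simp add: distrib_right)
qed

lemma residue_nonneg_iff: "k < t \<Longrightarrow> 0 \<le> i * int t + int k \<longleftrightarrow> 0 \<le> i"
  using residue_neg_iff[of k t i] by linarith

lemma finitary_sections:
  assumes "0 < t"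
  shows "finitary c \<longleftrightarrow> (\<forall>k<t. finitary (word_section t c k))"
  unfolding finitary_def word_section_def finite_residues[OF assms, of "\<lambda>i. i < 0 \<and> c i"]
    finite_residues[OF assms, of "\<lambda>i. 0 \<le> i \<and> \<not> c i"]
  by (auto simp: residue_neg_iff residue_nonneg_iff)

lemma finitary_section: "finitary c \<Longrightarrow> k < t \<Longrightarrow> finitary (word_section t c k)"
  using finitary_sections[of t c] by simp

lemma card_neg_sections:
  assumes "0 < t" "finitary c"
  shows "card {i. i < 0 \<and> c i} = (\<Sum>k<t. card {i. i < 0 \<and> word_section t c k i})"
  using card_residues[OF assms(1), of "\<lambda>i. i < 0 \<and> c i"] assms(2)
  by (simp add: finitary_def word_section_def residue_neg_iff)

lemma card_nonneg_sections:
  assumes "0 < t" "finitary c"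
  shows "card {i. 0 \<le> i \<and> \<not> c i} = (\<Sum>k<t. card {i. 0 \<le> i \<and> \<not> word_section t c k i})"
  using card_residues[OF assms(1), of "\<lambda>i. 0 \<le> i \<and> \<not> c i"] assms(2)
  by (simp add: finitary_def word_section_def residue_nonneg_iff)

lemma charge_sections:
  "0 < t \<Longrightarrow> finitary c \<Longrightarrow> charge c = (\<Sum>k<t. charge (word_section t c k))"
  by (simp add: charge_def card_neg_sections card_nonneg_sections sum_subtractf)

lemma word_eqI_sections:
  assumes "0 < t" "\<And>k. k < t \<Longrightarrow> word_section t c k = word_section t d k"
  shows "c = d"
proof
  fix x
  have "nat (x mod int t) < t" using assms(1) by (simp add: nat_less_iff)
  from fun_cong[OF assms(2)[OF this], of "x div int t"] show "c x = d x"
    using assms(1) by (simp add: word_section_def)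
qed

text \<open>Reflection about -1/2 sends the residue \<open>k\<close> to \<open>t - 1 - k\<close> and
  acts on quotients by the same formula \<open>- 1 - i\<close>.\<close>

lemma dual_section:
  assumes "dual c = c" "k < t"
  shows "word_section t c (t - 1 - k) = dual (word_section t c k)"
proof
  fix i
  have "- 1 - (i * int t + int (t - 1 - k)) = (- 1 - i) * int t + int k"
    using assms(2) by (simp add: of_nat_diff algebra_simps)
  then show "word_section t c (t - 1 - k) i = dual (word_section t c k) i"
    using fun_cong[OF assms(1), of "i * int t + int (t - 1 - k)"]
    by (simp add: word_section_def dual_def)
qed

section \<open>Sorting of sections and the t-core\<close>

lemma sorted_word_charge:
  assumes "\<And>i. w i \<longleftrightarrow> m \<le> i"
  shows "finitary w" "charge w = m" "card {i. i < 0 \<and> w i} = nat (- m)"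
proof -
  have neg: "{i. i < 0 \<and> w i} = {m..<0}" and nonneg: "{i. 0 \<le> i \<and> \<not> w i} = {0..<m}"
    unfolding assms by auto
  show "finitary w" "charge w = m" "card {i. i < 0 \<and> w i} = nat (- m)"
    unfolding finitary_def charge_def neg nonneg card_atLeastLessThan_int by simp_all
qed

text \<open>The swap moves a zero from \<open>i + 1\<close> to \<open>i\<close>. Since
  \<open>i\<close> carried a one, the zero does not leave the range starting at
  \<open>N\<close>.\<close>

lemma swap_zeros:
  fixes N :: int
  assumes "\<forall>i<N. \<not> c i" "c i" "\<not> c (i + 1)" "d = c(i := False, i + 1 := True)"
  shows "N \<le> i" "\<forall>x<N. \<not> d x"
    "{x. N \<le> x \<and> \<not> d x} = insert i ({x. N \<le> x \<and> \<not> c x} - {i + 1})"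
proof -
  show N: "N \<le> i" using assms(1,2) by (meson not_le)
  show "\<forall>x<N. \<not> d x" using assms(1) N by (simp add: assms(4))
  show "{x. N \<le> x \<and> \<not> d x} = insert i ({x. N \<le> x \<and> \<not> c x} - {i + 1})"
    using N assms(2-4) by auto
qed

text \<open>Measured from a fixed \<open>N\<close> left of all ones, the charge counts zeros, and a
  swap exchanges one zero for another.\<close>

lemma swap_step_charge:
  assumes "finitary c" "swap_step c d"
  shows "finitary d \<and> charge d = charge c"
proof -
  obtain N where N: "N \<le> 0" "\<forall>i<N. \<not> c i" "finite {i. N \<le> i \<and> \<not> c i}"
    using finitary_bound[OF assms(1)] by blast
  obtain i where i: "c i" "\<not> c (i + 1)" "d = c(i := False, i + 1 := True)"
    using assms(2) by (auto simp: swap_step_def)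
  note zeros = swap_zeros[OF N(2) i]
  have mem: "i + 1 \<in> {x. N \<le> x \<and> \<not> c x}" "i \<notin> {x. N \<le> x \<and> \<not> c x} - {i + 1}"
    using i zeros(1) by auto
  have "card {x. N \<le> x \<and> \<not> d x} = card {x. N \<le> x \<and> \<not> c x}"
    unfolding zeros(3)
    using card_insert_disjoint[OF finite_Diff[OF N(3)] mem(2)] card_Suc_Diff1[OF N(3) mem(1)]
    by (simp only:)
  moreover have "finite {x. N \<le> x \<and> \<not> d x}" unfolding zeros(3) using N(3) by simp
  ultimately show ?thesis
    using finitary_charge_bound[OF N(1) zeros(2)] finitary_charge_bound[OF N] by simp
qed

text \<open>Finitely many zeros from \<open>N\<close> on force a one there; the first one then
  propagates to the right.\<close>

lemma sorted_wordI:
  fixes N :: int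
  assumes "\<forall>i<N. \<not> c i" "finite {i. N \<le> i \<and> \<not> c i}" "\<And>i. c i \<Longrightarrow> c (i + 1)"
  shows "sorted_word c"
proof -
  have "\<exists>n. c (N + int n)"
  proof (rule ccontr)
    assume "\<nexists>n. c (N + int n)"
    then have "range (\<lambda>n. N + int n) \<subseteq> {i. N \<le> i \<and> \<not> c i}" by auto
    moreover have "infinite (range (\<lambda>n. N + int n))"
      using finite_imageD[of "\<lambda>n. N + int n" UNIV] by (auto simp: inj_def)
    ultimately show False using assms(2) finite_subset by blast
  qed
  then obtain n where n: "c (N + int n)" "\<And>k. k < n \<Longrightarrow> \<not> c (N + int k)"
    using exists_least_iff[of "\<lambda>n. c (N + int n)"] by blast
  have "c i \<longleftrightarrow> N + int n \<le> i" for i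
  proof
    assume "N + int n \<le> i"
    then show "c i" by (induction rule: int_ge_induct) (use n(1) assms(3) in auto)
  next
    assume c: "c i"
    then have N: "N \<le> i" using assms(1) by (meson not_le)
    then have "\<not> nat (i - N) < n" using n(2)[of "nat (i - N)"] c by auto
    then show "N + int n \<le> i" using N by linarith
  qed
  then show ?thesis unfolding sorted_word_def by blast
qed

lemma sort_exists:
  assumes "finitary c"
  shows "\<exists>w. swap_step\<^sup>*\<^sup>* c w \<and> sorted_word w"
proof -
  obtain N where N: "N \<le> 0" "\<forall>i<N. \<not> c i" "finite {i. N \<le> i \<and> \<not> c i}"
    using finitary_bound[OF assms] by blast
  \<comment> \<open>A swap moves one zero one step to the left, so the sum of the distances to \<open>N\<close> decreases.\<close>
  from N(2,3) show ?thesis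
  proof (induction "\<Sum>x\<in>{x. N \<le> x \<and> \<not> c x}. nat (x - N)" arbitrary: c rule: less_induct)
    case (less c)
    show ?case
    proof (cases "\<exists>i. c i \<and> \<not> c (i + 1)")
      case True
      then obtain i where i: "c i" "\<not> c (i + 1)" by blast
      define d where "d = c(i := False, i + 1 := True)"
      note zeros = swap_zeros[OF less.prems(1) i d_def]
      let ?Z = "{x. N \<le> x \<and> \<not> c x}"
      have mem: "i + 1 \<in> ?Z" "i \<notin> ?Z - {i + 1}" using i zeros(1) by auto
      have "(\<Sum>x\<in>{x. N \<le> x \<and> \<not> d x}. nat (x - N)) = nat (i - N) + (\<Sum>x\<in>?Z - {i + 1}. nat (x - N))"
        unfolding zeros(3) by (rule sum.insert) (use less.prems(2) mem in auto)
      also have "\<dots> < nat (i + 1 - N) + (\<Sum>x\<in>?Z - {i + 1}. nat (x - N))"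
        using zeros(1) by simp
      also have "\<dots> = (\<Sum>x\<in>?Z. nat (x - N))"
        by (rule sum.remove[symmetric, OF less.prems(2) mem(1)])
      finally have "\<exists>w. swap_step\<^sup>*\<^sup>* d w \<and> sorted_word w"
        by (rule less.hyps) (use zeros(2) less.prems(2) in \<open>simp_all add: zeros(3)\<close>)
      moreover have "swap_step c d" using i d_def by (auto simp: swap_step_def)
      ultimately show ?thesis by (blast intro: converse_rtranclp_into_rtranclp)
    next
      case False
      then have "sorted_word c" using less.prems by (intro sorted_wordI[of N]) auto
      then show ?thesis by blast
    qed
  qed
qed

text \<open>Swaps preserve the charge, and a sorted word starting its ones at \<open>m\<close> has
  charge \<open>m\<close>; so the result does not depend on the order of the swaps.\<close>

lemma sort_word_eq:
  assumes "finitary c"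
  shows "sort_word c = (\<lambda>i. charge c \<le> i)"
proof -
  have unique: "w = (\<lambda>i. charge c \<le> i)" if w: "swap_step\<^sup>*\<^sup>* c w" "sorted_word w" for w
  proof -
    have "finitary w \<and> charge w = charge c"
      using w(1) by induction (use assms swap_step_charge in auto)
    moreover obtain m where m: "\<And>i. w i \<longleftrightarrow> m \<le> i" using w(2) by (auto simp: sorted_word_def)
    ultimately have "m = charge c" using sorted_word_charge(2)[OF m] by simp
    then show ?thesis using m by (intro ext) simp
  qed
  show ?thesis
    unfolding sort_word_def
  proof (rule the_equality)
    show "swap_step\<^sup>*\<^sup>* c (\<lambda>i. charge c \<le> i) \<and> sorted_word (\<lambda>i. charge c \<le> i)"
      using sort_exists[OF assms] unique by auto
  qed (use unique in blast)
qed

text \<open>The sorted sections are interleaved into one word. Its charge is the sum of the section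
  charges, which is that of \<open>canonical l\<close>, namely 0; so it is the canonical word of a
  partition.\<close>

lemma t_core:
  assumes "0 < t" "is_partition l"
  shows "is_partition (t_core t l)"
    and "k < t \<Longrightarrow> word_section t (canonical (t_core t l)) k
           = (\<lambda>i. charge (word_section t (canonical l) k) \<le> i)"
proof -
  define m where "m k = charge (word_section t (canonical l) k)" for k
  define c where "c x \<longleftrightarrow> m (nat (x mod int t)) \<le> x div int t" for x
  have fin: "finitary (word_section t (canonical l) k)" if "k < t" for k
    by (rule finitary_section[OF canonical(3)[OF assms(2)] that])
  have sec: "word_section t c k = (\<lambda>i. m k \<le> i)" if "k < t" for k
  proof
    fix i
    have "(i * int t + int k) mod int t = int k" "(i * int t + int k) div int t = i"
      using that by simp_all
    then show "word_section t c k i = (m k \<le> i)" by (simp add: word_section_def c_def)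
  qed
  have fin_c: "finitary c"
    by (subst finitary_sections[OF assms(1)]) (simp add: sec sorted_word_charge(1)[OF refl])
  have charge_c: "charge c = 0"
  proof -
    have "charge c = (\<Sum>k<t. charge (word_section t c k))"
      by (rule charge_sections[OF assms(1) fin_c])
    also have "\<dots> = (\<Sum>k<t. m k)"
      by (intro sum.cong refl) (simp add: sec sorted_word_charge(2)[OF refl])
    also have "\<dots> = charge (canonical l)"
      unfolding m_def by (rule charge_sections[symmetric, OF assms(1) canonical(3)[OF assms(2)]])
    finally show ?thesis using canonical(2)[OF assms(2)] by simp
  qed
  note p = psi_inv(1)[OF fin_c] canonical_psi_inv[OF fin_c charge_c]
  have "t_core t l = psi_inv c"
    unfolding t_core_def
  proof (rule the_equality)
    show "is_partition (psi_inv c) \<and> (\<forall>k<t. word_section t (canonical (psi_inv c)) k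
        = sort_word (word_section t (canonical l) k))"
      using p sec sort_word_eq[OF fin] by (simp add: m_def)
  next
    fix l'
    assume l': "is_partition l' \<and>
      (\<forall>k<t. word_section t (canonical l') k = sort_word (word_section t (canonical l) k))"
    have "canonical l' = c"
      by (rule word_eqI_sections[OF assms(1)]) (simp add: l' sec sort_word_eq[OF fin] m_def)
    then show "l' = psi_inv c" using l' p by (intro canonical_inj) simp_all
  qed
  then show "is_partition (t_core t l)"
    "k < t \<Longrightarrow> word_section t (canonical (t_core t l)) k
       = (\<lambda>i. charge (word_section t (canonical l) k) \<le> i)"
    using p sec by (simp_all add: m_def)
qed

text \<open>The reflection \<open>k \<mapsto> t - 1 - k\<close> matches the first \<open>n\<close>
  terms with the last \<open>n\<close>; for odd \<open>t\<close> the index \<open>n\<close> is its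
  own mirror image.\<close>

lemma sum_symmetric:
  fixes f :: "nat \<Rightarrow> nat"
  assumes "\<And>k. k < t \<Longrightarrow> f (t - 1 - k) = f k"
  shows "t = 2 * n \<Longrightarrow> even (\<Sum>k<t. f k)" "t = 2 * n + 1 \<Longrightarrow> even (\<Sum>k<t. f k) = even (f n)"
proof -
  \<comment> \<open>The set \<open>{t - n..<t}\<close> is the last \<open>n\<close> indices for
    either parity of \<open>t\<close>.\<close>
  have half: "(\<Sum>k\<in>{t - n..<t}. f k) = (\<Sum>k<n. f k)" if "2 * n \<le> t"
    by (rule sum.reindex_bij_witness[of _ "\<lambda>k. t - 1 - k" "\<lambda>k. t - 1 - k"])
      (use that assms in auto)
  { assume t: "t = 2 * n"
    have "(\<Sum>k<t. f k) = (\<Sum>k<n. f k) + (\<Sum>k\<in>{n..<t}. f k)"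
      using t by (simp add: lessThan_atLeast0 sum.atLeastLessThan_concat)
    then show "even (\<Sum>k<t. f k)" using half t by simp }
  { assume t: "t = 2 * n + 1"
    have "(\<Sum>k<t. f k) = (\<Sum>k<Suc n. f k) + (\<Sum>k\<in>{Suc n..<t}. f k)"
      using t by (simp add: lessThan_atLeast0 sum.atLeastLessThan_concat del: sum.lessThan_Suc sum.op_ivl_Suc)
    moreover have "(\<Sum>k<Suc n. f k) = (\<Sum>k<n. f k) + f n" by simp
    moreover have "t - n = Suc n" using t by simp
    note half[unfolded this]
    ultimately have "(\<Sum>k<t. f k) = 2 * (\<Sum>k<n. f k) + f n" using t by linarith
    then show "even (\<Sum>k<t. f k) = even (f n)" by simp }
qed

section \<open>Self-conjugate partitions\<close>

lemma delta_eqI: "even (durfee l + n) \<Longrightarrow> delta l = (- 1) ^ n"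
  by (cases "even n") (auto simp: delta_def)

lemma even_durfee_add_core:
  assumes "0 < t" "is_partition l" "self_conjugate l"
  shows "even (durfee l + durfee (t_core t l)) \<longleftrightarrow>
     even (\<Sum>k<t. max (card {i. i < 0 \<and> word_section t (canonical l) k i})
                       (card {i. i < 0 \<and> word_section t (canonical l) (t - 1 - k) i}))"
proof -
  define d where "d k = card {i. i < 0 \<and> word_section t (canonical l) k i}" for k
  have dual: "dual (canonical l) = canonical l" by (rule dual_canonical[OF assms(2,3)])
  have d_dual: "d (t - 1 - k) = card {i. 0 \<le> i \<and> \<not> word_section t (canonical l) k i}"
    if "k < t" for k
    unfolding d_def dual_section[OF dual that] by (rule card_dual_neg)
  have "durfee (t_core t l) = (\<Sum>k<t. card {i. i < 0 \<and> word_section t (canonical (t_core t l)) k i})"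
    using t_core(1)[OF assms(1,2)] by (simp add: durfee_eq card_neg_sections[OF assms(1)] canonical(3))
  also have "\<dots> = (\<Sum>k<t. nat (int (d k) - int (d (t - 1 - k))))"
  proof (intro sum.cong refl)
    fix k assume "k \<in> {..<t}"
    then have k: "k < t" by simp
    have "card {i. i < 0 \<and> word_section t (canonical (t_core t l)) k i}
        = nat (- charge (word_section t (canonical l) k))"
      by (rule sorted_word_charge(3)) (simp add: t_core(2)[OF assms(1,2) k])
    also have "\<dots> = nat (int (d k) - int (d (t - 1 - k)))"
      unfolding d_dual[OF k] unfolding charge_def d_def by simp
    finally show "card {i. i < 0 \<and> word_section t (canonical (t_core t l)) k i}
        = nat (int (d k) - int (d (t - 1 - k)))" .
  qed
  \<comment> \<open>Truncated subtraction on naturals expresses that only sections of negative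
    charge contribute.\<close>
  finally have core: "durfee (t_core t l) = (\<Sum>k<t. d k - d (t - 1 - k))"
    by (simp add: nat_minus_as_int)
  have "durfee l = (\<Sum>k<t. d k)"
    using assms(2) by (simp add: durfee_eq card_neg_sections[OF assms(1)] canonical(3) d_def)
  \<comment> \<open>The reversed sum prepares the termwise identity
    \<open>b + (a - b) = max a b\<close>, valid for truncated subtraction.\<close>
  also have "\<dots> = (\<Sum>k<t. d (t - 1 - k))"
    using sum.nat_diff_reindex[of d t] by simp
  finally have "durfee l + durfee (t_core t l) = (\<Sum>k<t. d (t - 1 - k) + (d k - d (t - 1 - k)))"
    using core by (simp add: sum.distrib)
  also have "\<dots> = (\<Sum>k<t. max (d k) (d (t - 1 - k)))"
    by (intro sum.cong refl) auto
  finally show ?thesis by (simp add: d_def)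
qed

section \<open>Boxes of the quotient inside the partition\<close>

lemma assoc_box_eq:
  assumes "0 < t" "is_partition l" "k < t"
    and "box_corresp (word_section t (canonical l) k) (i, j) v"
  shows "assoc_box t l k v =
    (card {x. j * int t + int k \<le> x \<and> \<not> canonical l x},
     card {x. x \<le> i * int t + int k \<and> canonical l x})"
proof -
  have "finitary (word_section t (canonical l) k)"
    by (rule finitary_section[OF canonical(3)[OF assms(2)] assms(3)])
  then have pos: "positions_of_box (word_section t (canonical l) k) v = (i, j)"
    by (rule positions_of_box_eq) fact
  have "i < j" "word_section t (canonical l) k i" "\<not> word_section t (canonical l) k j"
    using assms(4) by (auto simp: box_corresp_def split: prod.splits)
  then show ?thesis
    unfolding assoc_box_def pos prod.case
    using assms(1) by (simp add: box_of_positions_eq word_section_def)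
qed

text \<open>This is \<open>above_dual\<close> for the lifted pair: the expression on the right is
  the sum of its two positions plus one.\<close>

lemma assoc_box_diagonal:
  assumes "0 < t" "is_partition l" "self_conjugate l" "k < t"
    and "box_corresp (word_section t (canonical l) k) (i, j) v"
  shows "strictly_above (assoc_box t l k v) \<longleftrightarrow> (i + j) * int t + 2 * int k + 1 < 0"
    and "strictly_below (assoc_box t l k v) \<longleftrightarrow> 0 < (i + j) * int t + 2 * int k + 1"
proof -
  have ij: "canonical l (i * int t + int k)" "\<not> canonical l (j * int t + int k)"
    using assms(5) by (auto simp: box_corresp_def word_section_def split: prod.splits)
  note * = above_dual[OF canonical(3)[OF assms(2)] dual_canonical[OF assms(2,3)] ij]
  have eq: "i * int t + int k + (j * int t + int k) + 1 = (i + j) * int t + 2 * int k + 1"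
    by (simp add: algebra_simps)
  show "strictly_above (assoc_box t l k v) \<longleftrightarrow> (i + j) * int t + 2 * int k + 1 < 0"
    "strictly_below (assoc_box t l k v) \<longleftrightarrow> 0 < (i + j) * int t + 2 * int k + 1"
    unfolding assoc_box_eq[OF assms(1,2,4,5)] strictly_above_def strictly_below_def fst_conv snd_conv
    using *[unfolded eq] by simp_all
qed

theorem lemma2p4:
  fixes t :: nat and lam core :: "nat list" and quot :: "nat list list"
  assumes "0 < t"
    and "is_partition lam"
    and "self_conjugate lam"
    and "littlewood t lam = (core, quot)"
  shows "((\<forall>t'. t = 2 * t' + 1 \<longrightarrow> delta lam = delta core * delta (quot ! t'))
          \<and> (even t \<longrightarrow> delta lam = delta core))
    \<and> (\<forall>t' v. t = 2 * t' + 1 \<and> v \<in> boxes (quot ! t') \<longrightarrow>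
          (strictly_above v \<longleftrightarrow> strictly_above (assoc_box t lam t' v)))
    \<and> (\<forall>t' i j k. (t = 2 * t' \<or> t = 2 * t' + 1) \<and> i < t' \<and> (j, k) \<in> boxes (quot ! i) \<longrightarrow>
          (let V = assoc_box t lam i (j, k); V' = assoc_box t lam (t - 1 - i) (k, j) in
             (strictly_above V \<longrightarrow> strictly_below V')
             \<and> (strictly_below V \<longrightarrow> strictly_above V')
             \<and> eps V * eps V' = - 1
             \<and> (j \<noteq> k \<longrightarrow> eps (j, k) * eps (k, j) = - 1)))"
proof -
  define w where "w k = word_section t (canonical lam) k" for k
  have core: "core = t_core t lam" and quot: "\<And>k. k < t \<Longrightarrow> quot ! k = psi_inv (w k)"
    using assms(4) by (auto simp: littlewood_def w_def)
  have fin: "finitary (w k)" if "k < t" for k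
    unfolding w_def by (rule finitary_section[OF canonical(3)[OF assms(2)] that])
  have dual: "w (t - 1 - k) = dual (w k)" if "k < t" for k
    unfolding w_def by (rule dual_section[OF dual_canonical[OF assms(2,3)] that])
  have box: "v \<in> boxes (quot ! k) \<longleftrightarrow> (\<exists>p. box_corresp (w k) p v)" if "k < t" for k v
    unfolding quot[OF that] by (rule boxes_iff[OF psi_inv[OF fin[OF that]]])
  define f where "f k = max (card {i. i < 0 \<and> w k i}) (card {i. i < 0 \<and> w (t - 1 - k) i})" for k
  have parity: "even (durfee lam + durfee core) \<longleftrightarrow> even (\<Sum>k<t. f k)"
    unfolding core f_def w_def by (rule even_durfee_add_core[OF assms(1-3)])
  have f_sym: "f (t - 1 - k) = f k" if "k < t" for k
    using that by (simp add: f_def max.commute)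
  have mid: "dual (w t') = w t'" if "t = 2 * t' + 1" for t'
    using dual[of t'] that by simp
  have i_odd: "delta lam = delta core * delta (quot ! t')" if t: "t = 2 * t' + 1" for t'
  proof -
    have t': "t' < t" "t - 1 - t' = t'" using t by auto
    \<comment> \<open>The middle section is self-dual, hence of charge 0 and already canonical; both
      arguments of the maximum in \<open>f t'\<close> coincide.\<close>
    have "durfee (quot ! t') = f t'"
      using t' fin[OF t'(1)] charge_dual_eq_0[OF mid[OF t]]
      by (simp add: quot durfee_eq psi_inv canonical_psi_inv f_def)
    then have "even (durfee lam + (durfee core + durfee (quot ! t')))"
      using parity sum_symmetric(2)[of t f t', OF f_sym t] by simp blast
    from delta_eqI[OF this] show ?thesis by (simp add: delta_def power_add)
  qed
  have i_even: "delta lam = delta core" if "even t"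
  proof -
    obtain n where "t = 2 * n" using \<open>even t\<close> by blast
    then have "even (durfee lam + durfee core)"
      using parity sum_symmetric(1)[of t f n, OF f_sym] by simp
    from delta_eqI[OF this] show ?thesis by (simp add: delta_def)
  qed
  have ii: "strictly_above v \<longleftrightarrow> strictly_above (assoc_box t lam t' v)"
    if t: "t = 2 * t' + 1" and v: "v \<in> boxes (quot ! t')" for t' v
  proof -
    have t': "t' < t" using t by auto
    obtain i j where p: "box_corresp (w t') (i, j) v" 
      using box[OF t', THEN iffD1, OF v] by (metis surj_pair)
    then have ij: "w t' i" "\<not> w t' j" and
      v_eq: "v = (card {x. j \<le> x \<and> \<not> w t' x}, card {x. x \<le> i \<and> w t' x})"
      by (auto simp: box_corresp_def split: prod.splits)
    have "strictly_above v \<longleftrightarrow> i + j + 1 < 0"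
      unfolding v_eq strictly_above_def fst_conv snd_conv
      by (rule above_dual(1)[OF fin[OF t'] mid[OF t] ij])
    \<comment> \<open>For the middle section the lifted quantity is a positive multiple of the one
      for \<open>v\<close>, so the signs agree.\<close>
    moreover have "(i + j) * int t + 2 * int t' + 1 = (i + j + 1) * int t"
      using t by (simp add: algebra_simps)
    ultimately show ?thesis
      using assoc_box_diagonal(1)[OF assms(1-3) t' p[unfolded w_def]] assms(1)
      by (simp add: mult_less_0_iff)
  qed
  have iii: "(strictly_above V \<longrightarrow> strictly_below V') \<and> (strictly_below V \<longrightarrow> strictly_above V')
      \<and> eps V * eps V' = - 1 \<and> (j \<noteq> k \<longrightarrow> eps (j, k) * eps (k, j) = - 1)"
    if t: "t = 2 * t' \<or> t = 2 * t' + 1" and "i < t'" and v: "(j, k) \<in> boxes (quot ! i)"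
      and V: "V = assoc_box t lam i (j, k)" and V': "V' = assoc_box t lam (t - 1 - i) (k, j)"
    for t' i j k V V'
  proof -
    have i: "i < t" "2 * i + 1 < t" using t \<open>i < t'\<close> by auto
    then have i': "t - 1 - i < t" by simp
    obtain x y where p: "box_corresp (w i) (x, y) (j, k)" 
      using box[OF i(1), THEN iffD1, OF v] by (metis surj_pair)
    define S where "S = (x + y) * int t + 2 * int i + 1"
    have V_above: "strictly_above V \<longleftrightarrow> S < 0" and V_below: "strictly_below V \<longleftrightarrow> 0 < S"
      unfolding V S_def using assoc_box_diagonal[OF assms(1-3) i(1) p[unfolded w_def]] by blast+
    \<comment> \<open>The transposed box sits at the reflected pair in the mirror section, so
      lifting it negates \<open>S\<close>.\<close>
    have "box_corresp (w (t - 1 - i)) (- 1 - y, - 1 - x) (k, j)"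
      unfolding dual[OF i(1)] box_corresp_dual using p by simp
    note diag' = assoc_box_diagonal[OF assms(1-3) i' this[unfolded w_def]]
    have "((- 1 - y) + (- 1 - x)) * int t + 2 * int (t - 1 - i) + 1 = - S"
      using i(1) by (simp add: S_def of_nat_diff algebra_simps)
    then have V'_above: "strictly_above V' \<longleftrightarrow> 0 < S" and V'_below: "strictly_below V' \<longleftrightarrow> S < 0"
      unfolding V' using diag' by simp_all
    \<comment> \<open>\<open>V\<close> is never on the diagonal: \<open>S = 0\<close> would make
      \<open>t\<close> divide \<open>2 * i + 1\<close>, which lies strictly between 0 and
      \<open>t\<close>.\<close>
    have "S \<noteq> 0"
    proof
      assume "S = 0"
      then have "2 * int i + 1 = (- (x + y)) * int t" by (simp add: S_def algebra_simps)
      then have "int t dvd 2 * int i + 1" by simp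
      then show False using i(2) zdvd_imp_le[of "int t" "2 * int i + 1"] by linarith
    qed
    \<comment> \<open>If \<open>j \<noteq> k\<close>, exactly one of \<open>(j, k)\<close> and
      \<open>(k, j)\<close> is strictly above the diagonal; for \<open>j = k\<close> both signs
      equal 1.\<close>
    then show ?thesis
      using V_above V_below V'_above V'_below
      by (auto simp: eps_def) (auto simp: strictly_above_def)
  qed
  show ?thesis
    unfolding Let_def using i_odd i_even ii iii by blast
qed

end
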